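(* For all integers $r \geq s \geq 0$ there exist positive constants $\varepsilon = \varepsilon(r,s)$, $\alpha = \alpha(r,s)$ and $n_1 = n_1(r,s)$ such that the following holds. Let $n \geq n_1$ and let $F \subseteq \binom{[n]}{r}$ be a family of at most $\varepsilon n \binom{n-s}{r-s}$ $r$-sets such that every $s$-set $S \in \binom{[n]}{s}$ is contained in fewer than $\alpha \binom{n-s}{r-s}$ members of $F$. Then $\mathrm{rk}\, M_s^r(K_n^r - F) = \binom{n}{s}$.
   Context: $K_n^r$ is the complete $r$-graph on vertex set $[n]$ (all $r$-subsets of $[n]$ as edges), and $K_n^r - F$ is the $r$-graph on $[n]$ with edge set $\binom{[n]}{r} \setminus F$. For an $r$-graph $G$ and $0 \le s \le r$, the higher inclusion matrix $M_s^r(G)$ is the $\{0,1\}$-matrix with rows indexed by the edges of $G$ and columns indexed by the $s$-subsets of $V(G)$, the entry for edge $e$ and $s$-set $S$ being $1$ if $S \subseteq e$ and $0$ otherwise; $\mathrm{rk}$ denotes rank over the reals. *)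

theory Defs
  imports Complex_Main "HOL-Library.Countable_Set" "HOL-Library.Ramsey"
    "Jordan_Normal_Form.DL_Rank"
begin

text \<open>A hypergraph is a pair of its vertex set and its edge set.  As in \<open>HOL-Library.Ramsey\<close>,
  \<open>nsets A k\<close> is the family of all \<open>k\<close>-element subsets of \<open>A\<close>.\<close>

type_synonym 'a hypergraph = "'a set \<times> 'a set set"

abbreviation verts :: "'a hypergraph \<Rightarrow> 'a set" where "verts \<equiv> fst"
abbreviation edges :: "'a hypergraph \<Rightarrow> 'a set set" where "edges \<equiv> snd"

definition complete_hypergraph :: "nat \<Rightarrow> nat \<Rightarrow> nat hypergraph" where
  "complete_hypergraph r n = ({1..n}, nsets {1..n} r)"

definition delete_edges :: "'a hypergraph \<Rightarrow> 'a set set \<Rightarrow> 'a hypergraph" where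
  "delete_edges G F = (verts G, edges G - F)"

text \<open>Matrices here have rows and columns numbered from 0, so the edges and the \<open>s\<close>-sets have to be
  enumerated.  For a finite set \<open>A\<close>, \<open>from_nat_into A\<close> is a bijection from \<open>{..<card A}\<close> to \<open>A\<close>
  (fact \<open>bij_betw_from_nat_into_finite\<close>); the choice of the enumeration only permutes rows and
  columns.  The definition is meant for hypergraphs with finitely many vertices.\<close>

definition inclusion_matrix :: "nat \<Rightarrow> 'a hypergraph \<Rightarrow> real mat" where
  "inclusion_matrix s G =
     mat (card (edges G)) (card (nsets (verts G) s))
       (\<lambda>(i, j). if from_nat_into (nsets (verts G) s) j \<subseteq> from_nat_into (edges G) i then 1 else 0)"

abbreviation mat_rank :: "real mat \<Rightarrow> nat" where
  "mat_rank A \<equiv> vec_space.rank (dim_row A) A"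

end

theory Submission
  imports Defs
begin

text \<open>Full column rank means that a function \<open>f\<close> on \<open>s\<close>-sets vanishes as soon as its sums over the
  \<open>s\<close>-subsets of \<open>e\<close> vanish for all \<open>r\<close>-sets \<open>e \<notin> F\<close>.  Induct on \<open>s\<close>: for vertices \<open>x \<noteq> y\<close>, the
  difference \<open>T \<mapsto> f (T \<union> {x}) - f (T \<union> {y})\<close> satisfies the same hypothesis for \<open>(s - 1, r - 1)\<close> on the
  remaining vertices, with \<open>F\<close> replaced by the union of the links of \<open>x\<close> and \<open>y\<close>.  Hence it is zero,
  so \<open>f\<close> is constant, and a single \<open>e \<notin> F\<close> forces the constant to be zero.  Each step at most doubles
  the degrees and removes two vertices, so it suffices that every \<open>j\<close>-set with \<open>j \<le> s\<close> lies in fewer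
  than \<open>2\<^sup>-\<^sup>j\<close> times \<open>(n - 2j) choose (r - j)\<close> members of \<open>F\<close>.  For \<open>j = s\<close> this is the
  hypothesis on degrees; for \<open>j < s\<close> it follows from the bound on the size of \<open>F\<close>.\<close>

section \<open>Sets of fixed size: splitting at a vertex, and exchanges\<close>

lemma nsets_insert_Suc:
  assumes "x \<notin> A"
  shows "nsets (insert x A) (Suc k) = nsets A (Suc k) \<union> insert x ` nsets A k"
proof (intro equalityI subsetI)
  fix S assume S: "S \<in> nsets (insert x A) (Suc k)"
  show "S \<in> nsets A (Suc k) \<union> insert x ` nsets A k"
  proof (cases "x \<in> S")
    case True
    then have "S = insert x (S - {x})" and "S - {x} \<in> nsets A k"
      using S by (auto simp: nsets_def)
    then show ?thesis by blast
  next
    case False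
    then show ?thesis using S by (auto simp: nsets_def)
  qed
next
  fix S assume "S \<in> nsets A (Suc k) \<union> insert x ` nsets A k"
  then show "S \<in> nsets (insert x A) (Suc k)"
    using assms by (auto simp: nsets_def card_insert_if)
qed

lemma sum_nsets_insert:
  assumes "finite A" "x \<notin> A"
  shows "(\<Sum>S\<in>nsets (insert x A) (Suc k). f S) =
    (\<Sum>S\<in>nsets A (Suc k). f S) + (\<Sum>T\<in>nsets A k. f (insert x T))"
proof -
  have "inj_on (insert x) (nsets A k)"
    using assms(2) by (intro inj_onI) (auto simp: nsets_def)
  moreover have "nsets A (Suc k) \<inter> insert x ` nsets A k = {}"
    using assms(2) by (auto simp: nsets_def)
  ultimately show ?thesis
    using assms by (simp add: nsets_insert_Suc sum.union_disjoint finite_imp_finite_nsets sum.reindex)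
qed

text \<open>Two sets of equal size are joined by a chain of single-element exchanges. Each exchange
  trades an \<open>x\<close> in \<open>A - B\<close> for a \<open>y\<close> in \<open>B - A\<close>,
  so \<open>card (A - B)\<close> drops.\<close>

lemma nsets_exchange_const:
  assumes swap: "\<And>x y T. \<lbrakk>x \<in> V; y \<in> V; x \<noteq> y; T \<in> nsets (V - {x, y}) k\<rbrakk>
      \<Longrightarrow> f (insert x T) = f (insert y T)"
    and "A \<in> nsets V (Suc k)" "B \<in> nsets V (Suc k)"
  shows "f A = f B"
  using assms(2)
proof (induction "card (A - B)" arbitrary: A rule: less_induct)
  case less
  have A: "A \<subseteq> V" "finite A" "card A = Suc k" and B: "B \<subseteq> V" "finite B" "card B = Suc k"
    using less.prems assms(3) by (auto simp: nsets_def)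
  show ?case
  proof (cases "A \<subseteq> B")
    case True
    then have "A = B" using A B by (intro card_subset_eq) auto
    then show ?thesis by simp
  next
    case False
    then obtain x where x: "x \<in> A" "x \<notin> B" by blast
    have "\<not> B \<subseteq> A" using False A B by (metis card_subset_eq order_refl)
    then obtain y where y: "y \<in> B" "y \<notin> A" by blast
    define T where "T = A - {x}"
    have T: "T \<in> nsets (V - {x, y}) k" "A = insert x T" "y \<notin> T"
      using A x y by (auto simp: T_def nsets_def)
    have "insert y T - B \<subset> A - B" using x y by (auto simp: T_def)
    then have "card (insert y T - B) < card (A - B)"
      using A by (intro psubset_card_mono) auto
    moreover have "insert y T \<in> nsets V (Suc k)"
      using T B y by (auto simp: nsets_def)
    ultimately have "f (insert y T) = f B" using less.hyps by blast
    moreover have "f (insert x T) = f (insert y T)"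
      using A B x y T by (intro swap) auto
    ultimately show ?thesis using T by simp
  qed
qed

section \<open>Injectivity of the inclusion map, by induction on \<open>s\<close>\<close>

lemma inclusion_sums_determine:
  fixes f :: "'a set \<Rightarrow> 'b::{idom, ring_char_0}"
  assumes "finite V" "finite F" "s \<le> r"
    and "\<And>T. \<lbrakk>T \<subseteq> V; card T \<le> s\<rbrakk> \<Longrightarrow>
      2 ^ card T * card {e \<in> F. T \<subseteq> e} < (card V - 2 * card T) choose (r - card T)"
    and "\<And>e. e \<in> nsets V r - F \<Longrightarrow> (\<Sum>S\<in>nsets e s. f S) = 0"
    and "S \<in> nsets V s"
  shows "f S = 0"
  using assms
proof (induction s arbitrary: V r F f S)
  case 0
  \<comment> \<open>At \<open>T = {}\<close> the degree hypothesis leaves an \<open>r\<close>-set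
    outside \<open>F\<close>; its only \<open>0\<close>-subset is \<open>{}\<close>.\<close>
  have "card F < card (nsets V r)" using "0.prems"(4)[of "{}"] by simp
  then have "\<not> nsets V r \<subseteq> F" using "0.prems"(2) card_mono by (metis not_less)
  then show ?case using "0.prems"(5,6) by auto
next
  case (Suc k)
  from Suc.prems(3) obtain q where q: "r = Suc q" "k \<le> q" by (cases r) auto
  have const: "f A = f B" if "A \<in> nsets V (Suc k)" "B \<in> nsets V (Suc k)" for A B
  proof (rule nsets_exchange_const[OF _ that])
    fix x y T
    assume xy: "x \<in> V" "y \<in> V" "x \<noteq> y" and T: "T \<in> nsets (V - {x, y}) k"
    define V' where "V' = V - {x, y}"
    \<comment> \<open>With the union of the two links, a \<open>q\<close>-set outside
      \<open>F'\<close> extends by \<open>x\<close> and by \<open>y\<close> to sets outside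
      \<open>F\<close>, so both sums over these extensions vanish.\<close>
    define F' where "F' = {e \<in> nsets V' q. insert x e \<in> F \<or> insert y e \<in> F}"
    have cV': "card V' = card V - 2"
      unfolding V'_def using xy Suc.prems(1) by (subst card_Diff_subset) auto
    have fin: "finite V'" "finite F'"
      using Suc.prems(1) by (auto simp: V'_def F'_def finite_imp_finite_nsets)
    have "f (insert x T) - f (insert y T) = 0"
    proof (rule Suc.IH[where V = V' and F = F' and r = q and S = T
          and f = "\<lambda>U. f (insert x U) - f (insert y U)"])
      fix U assume U: "U \<subseteq> V'" "card U \<le> k"
      then have U': "finite U" "x \<notin> U" "y \<notin> U" "U \<subseteq> V"
        using fin finite_subset by (auto simp: V'_def)
      have link: "card {e \<in> nsets V' q. insert z e \<in> F \<and> U \<subseteq> e} \<le> card {e \<in> F. insert z U \<subseteq> e}"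
        if "z \<notin> V'" for z
      proof (rule card_inj_on_le[where f = "insert z"])
        show "inj_on (insert z) {e \<in> nsets V' q. insert z e \<in> F \<and> U \<subseteq> e}"
          using that by (intro inj_onI) (auto simp: nsets_def)
      qed (use Suc.prems(2) in auto)
      have "{e \<in> F'. U \<subseteq> e} = {e \<in> nsets V' q. insert x e \<in> F \<and> U \<subseteq> e}
          \<union> {e \<in> nsets V' q. insert y e \<in> F \<and> U \<subseteq> e}"
        by (auto simp: F'_def)
      then have "card {e \<in> F'. U \<subseteq> e} \<le> card {e \<in> F. insert x U \<subseteq> e} + card {e \<in> F. insert y U \<subseteq> e}"
        using link[of x] link[of y] card_Un_le[of "{e \<in> nsets V' q. insert x e \<in> F \<and> U \<subseteq> e}"
            "{e \<in> nsets V' q. insert y e \<in> F \<and> U \<subseteq> e}"]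
        by (simp add: V'_def)
      then have "2 ^ card U * card {e \<in> F'. U \<subseteq> e} \<le>
          2 ^ card U * card {e \<in> F. insert x U \<subseteq> e} + 2 ^ card U * card {e \<in> F. insert y U \<subseteq> e}"
        unfolding distrib_left[symmetric] by (rule mult_le_mono2)
      \<comment> \<open>The hypothesis at \<open>insert z U\<close>, one element larger than
        \<open>U\<close>: its extra factor 2 pays for adding the two links, and its extra 2 in
        \<open>card V - 2 * card T\<close> for the loss of \<open>x\<close> and
        \<open>y\<close>.\<close>
      moreover have "2 * (2 ^ card U * card {e \<in> F. insert z U \<subseteq> e}) <
          (card V - 2 - 2 * card U) choose (q - card U)" if "z \<in> {x, y}" for z
        using Suc.prems(4)[of "insert z U"] that xy U U' by (auto simp: q ac_simps)
      from this[of x] this[of y] have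
        "2 * (2 ^ card U * card {e \<in> F. insert x U \<subseteq> e}) < (card V - 2 - 2 * card U) choose (q - card U)"
        "2 * (2 ^ card U * card {e \<in> F. insert y U \<subseteq> e}) < (card V - 2 - 2 * card U) choose (q - card U)"
        by simp_all
      ultimately show "2 ^ card U * card {e \<in> F'. U \<subseteq> e} < (card V' - 2 * card U) choose (q - card U)"
        unfolding cV' by linarith
    next
      fix e assume e: "e \<in> nsets V' q - F'"
      have e': "finite e" "x \<notin> e" "y \<notin> e" "insert x e \<notin> F" "insert y e \<notin> F"
        using e by (auto simp: F'_def V'_def nsets_def)
      have "(\<Sum>S\<in>nsets (insert z e) (Suc k). f S) = 0" if "z \<in> {x, y}" for z
        using that e e' xy by (intro Suc.prems(5)) (auto simp: q nsets_def V'_def)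
      \<comment> \<open>In both sums the sets avoiding the added vertex are the
        \<open>Suc k\<close>-subsets of \<open>e\<close>; this common part cancels in the
        difference.\<close>
      from this[of x] this[of y]
      show "(\<Sum>U\<in>nsets e k. f (insert x U) - f (insert y U)) = 0"
        using e' by (simp add: sum_nsets_insert sum_subtractf add_eq_0_iff)
    qed (use fin q T in \<open>auto simp: V'_def\<close>)
    then show "f (insert x T) = f (insert y T)" by simp
  qed
  have "card F < card (nsets V r)" using Suc.prems(4)[of "{}"] by simp
  then have "\<not> nsets V r \<subseteq> F" using Suc.prems(2) card_mono by (metis not_less)
  then obtain e where e: "e \<in> nsets V r - F" by blast
  then have "0 = (\<Sum>A\<in>nsets e (Suc k). f A)" using Suc.prems(5) by simp
  also have "\<dots> = (\<Sum>A\<in>nsets e (Suc k). f S)"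
    using e Suc.prems(6) by (intro sum.cong const) (auto simp: nsets_def)
  also have "\<dots> = of_nat (card (nsets e (Suc k))) * f S" by simp
  also have "card (nsets e (Suc k)) = r choose Suc k" using e by (simp only: card_nsets) (auto simp: nsets_def)
  \<comment> \<open>The coefficient \<open>r choose Suc k\<close> is nonzero because
    \<open>Suc k \<le> r\<close> and the characteristic is 0.\<close>
  finally show ?case using Suc.prems(3) by (simp add: binomial_eq_0_iff)
qed

section \<open>Full column rank from a trivial kernel\<close>

lemma (in vec_space) trivial_kernel_full_rank:
  assumes A: "A \<in> carrier_mat n nc"
    and ker: "\<And>v. \<lbrakk>v \<in> carrier_vec nc; A *\<^sub>v v = 0\<^sub>v n\<rbrakk> \<Longrightarrow> v = 0\<^sub>v nc"
  shows "rank A = nc"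
proof -
  \<comment> \<open>Linear independence is stated for the set of columns, so repetitions must be
    excluded first: two equal columns would put a difference of unit vectors into the
    kernel.\<close>
  have dist: "distinct (cols A)"
    unfolding distinct_conv_nth
  proof (intro allI impI notI)
    fix i j assume "i < length (cols A)" "j < length (cols A)" "i \<noteq> j" "cols A ! i = cols A ! j"
    then have ij: "i < nc" "j < nc" "col A i = col A j" using A by auto
    have "A *\<^sub>v unit_vec nc k = col A k" if "k < nc" for k
      using A that by (intro eq_vecI) auto
    then have "A *\<^sub>v (unit_vec nc i - unit_vec nc j) = 0\<^sub>v n"
      using A ij by (simp add: mult_minus_distrib_mat_vec[OF A])
    then have "unit_vec nc i - unit_vec nc j = (0\<^sub>v nc :: 'a vec)" by (intro ker) auto
    then have "(unit_vec nc i - unit_vec nc j) $ i = (0 :: 'a)" using ij by simp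
    then show False using ij \<open>i \<noteq> j\<close> by simp
  qed
  then have "lin_indpt (set (cols A))" using lin_depE[OF A _ dist] ker by metis
  then show ?thesis using lin_indpt_full_rank[OF A dist] by blast
qed

text \<open>Through the enumerations a vector is a function on the \<open>s\<close>-sets, and
  multiplying it by the row of \<open>e\<close> sums that function over the \<open>s\<close>-subsets
  of \<open>e\<close>. Thus \<open>inj\<close> says that the kernel is trivial.\<close>

lemma inclusion_matrix_full_rank:
  assumes fin: "finite (verts G)" "finite (edges G)" and sub: "\<And>e. e \<in> edges G \<Longrightarrow> e \<subseteq> verts G"
    and inj: "\<And>f :: 'a set \<Rightarrow> real. (\<And>e. e \<in> edges G \<Longrightarrow> (\<Sum>S\<in>nsets e s. f S) = 0)
      \<Longrightarrow> (\<And>S. S \<in> nsets (verts G) s \<Longrightarrow> f S = 0)"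
  shows "mat_rank (inclusion_matrix s G) = card (verts G) choose s"
proof -
  let ?N = "nsets (verts G) s" and ?M = "inclusion_matrix s G"
  let ?g = "from_nat_into ?N" and ?h = "from_nat_into (edges G)"
  have finN: "finite ?N" using fin by (simp add: finite_imp_finite_nsets)
  have g: "bij_betw ?g {..<card ?N} ?N" and h: "bij_betw ?h {..<card (edges G)} (edges G)"
    using finN fin bij_betw_from_nat_into_finite by blast+
  have M: "?M \<in> carrier_mat (dim_row ?M) (card ?N)" and rows: "dim_row ?M = card (edges G)"
    by (auto simp: inclusion_matrix_def)
  have "v = 0\<^sub>v (card ?N)"
    if v: "v \<in> carrier_vec (card ?N)" and Mv: "?M *\<^sub>v v = 0\<^sub>v (dim_row ?M)" for v
  proof -
    define f where "f S = v $ the_inv_into {..<card ?N} ?g S" for S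
    have fg: "f (?g j) = v $ j" if "j < card ?N" for j
      using g that by (simp add: f_def bij_betw_def the_inv_into_f_f)
    have "(\<Sum>S\<in>nsets e s. f S) = 0" if e: "e \<in> edges G" for e
    proof -
      obtain i where i: "i < card (edges G)" "e = ?h i"
        using h e by (auto simp: bij_betw_def image_iff set_eq_iff)
      have "0 = (?M *\<^sub>v v) $ i" using Mv rows i by simp
      also have "\<dots> = (\<Sum>j<card ?N. (if ?g j \<subseteq> e then 1 else 0) * v $ j)"
        using v i by (simp add: inclusion_matrix_def scalar_prod_def atLeast0LessThan)
      also have "\<dots> = (\<Sum>j<card ?N. (if ?g j \<subseteq> e then f (?g j) else 0))"
        by (intro sum.cong) (auto simp: fg)
      also have "\<dots> = (\<Sum>S\<in>?N. if S \<subseteq> e then f S else 0)"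
        by (rule sum.reindex_bij_betw[OF g])
      also have "\<dots> = (\<Sum>S\<in>{S \<in> ?N. S \<subseteq> e}. f S)"
        using finN by (simp add: sum.inter_filter)
      also have "{S \<in> ?N. S \<subseteq> e} = nsets e s" using sub[OF e] by (auto simp: nsets_def)
      finally show ?thesis by simp
    qed
    then have f0: "f S = 0" if "S \<in> ?N" for S using inj that by blast
    show ?thesis
    proof (rule eq_vecI)
      fix j assume "j < dim_vec (0\<^sub>v (card ?N) :: real vec)"
      then have j: "j < card ?N" by simp
      then have "?g j \<in> ?N" using g by (auto simp: bij_betw_def)
      then show "v $ j = 0\<^sub>v (card ?N) $ j" using f0 fg j by (metis index_zero_vec(1))
    qed (use v in simp)
  qed
  then have "mat_rank ?M = card ?N" using vec_space.trivial_kernel_full_rank[OF M] by blast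
  then show ?thesis by simp
qed

section \<open>Binomial estimate and choice of constants\<close>

lemma binomial_ge_pow_div:
  assumes "4 * r < n" "j \<le> r"
  shows "real n ^ (r - j) / (2 * real r + 2) ^ r \<le> real ((n - 2 * j) choose (r - j))"
proof (cases "j = r")
  case True
  then show ?thesis by (simp add: divide_le_eq one_le_power)
next
  case False
  define m where "m = r - j"
  have m: "0 < m" "m \<le> r" using False assms by (auto simp: m_def)
  \<comment> \<open>The exponent \<open>r\<close> in the denominator makes the constant independent
    of \<open>j\<close>.\<close>
  have "real n ^ m / (2 * real r + 2) ^ r \<le> real n ^ m / (2 * real r + 2) ^ m"
    using m by (intro divide_left_mono power_increasing) auto
  also have "\<dots> = (real n / (2 * real r + 2)) ^ m" by (simp add: power_divide)
  also have "\<dots> \<le> (real (n - 2 * j) / real m) ^ m"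
  proof (intro power_mono)
    \<comment> \<open>From \<open>4 * r < n\<close> and \<open>j \<le> r\<close>, more than half of
      \<open>n\<close> remains in \<open>n - 2 * j\<close>.\<close>
    have "real n * real m \<le> (2 * real (n - 2 * j)) * (real r + 1)"
      using assms m by (intro mult_mono) auto
    then show "real n / (2 * real r + 2) \<le> real (n - 2 * j) / real m"
      using m by (simp add: field_simps)
  qed simp
  also have "\<dots> \<le> real ((n - 2 * j) choose m)"
    using assms m by (intro binomial_ge_n_over_k_pow_k) (auto simp: m_def)
  finally show ?thesis by (simp add: m_def)
qed

theorem theorem6:
  fixes r s :: nat
  assumes "s \<le> r"
  shows "\<exists>(\<epsilon>::real) (\<alpha>::real) (n1::nat). \<epsilon> > 0 \<and> \<alpha> > 0 \<and> n1 > 0 \<and>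
    (\<forall>n\<ge>n1. \<forall>F. F \<subseteq> nsets {1..n} r \<longrightarrow>
       real (card F) \<le> \<epsilon> * real n * real ((n - s) choose (r - s)) \<longrightarrow>
       (\<forall>S\<in>nsets {1..n} s.
          real (card {e\<in>F. S \<subseteq> e}) < \<alpha> * real ((n - s) choose (r - s))) \<longrightarrow>
       mat_rank (inclusion_matrix s (delete_edges (complete_hypergraph r n) F)) = n choose s)"
proof -
  define K :: real where "K = (2 * real r + 2) ^ r"
  \<comment> \<open>\<open>K\<close> is the loss in \<open>binomial_ge_pow_div\<close>,
    \<open>2 ^ s\<close> bounds the weights \<open>2 ^ card T\<close>, and the last factor 2 gives
    strictness. The same \<open>c\<close> serves as \<epsilon> and \<alpha>.\<close>
  define c where "c = 1 / (2 ^ Suc s * K)"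
  have K: "K > 0" by (simp add: K_def)
  then have c: "c > 0" by (simp add: c_def)
  have "mat_rank (inclusion_matrix s (delete_edges (complete_hypergraph r n) F)) = n choose s"
    if n: "n \<ge> 4 * r + 1" and F: "F \<subseteq> nsets {1..n} r"
      and few: "real (card F) \<le> c * real n * real ((n - s) choose (r - s))"
      and deg: "\<forall>S\<in>nsets {1..n} s. real (card {e\<in>F. S \<subseteq> e}) < c * real ((n - s) choose (r - s))"
    for n F
  proof -
    let ?G = "delete_edges (complete_hypergraph r n) F"
    have G: "verts ?G = {1..n}" "edges ?G = nsets {1..n} r - F"
      by (simp_all add: delete_edges_def complete_hypergraph_def)
    have finF: "finite F" using F finite_subset finite_imp_finite_nsets by blast
    have "(n - s) choose (r - s) \<le> (n - s) ^ (r - s)"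
      using n assms by (intro binomial_le_pow) auto
    also have "\<dots> \<le> n ^ (r - s)" by (simp add: power_mono)
    finally have upper: "real ((n - s) choose (r - s)) \<le> real n ^ (r - s)"
      by (metis of_nat_le_iff of_nat_power)
    have cond: "2 ^ card T * card {e \<in> F. T \<subseteq> e} < (card {1..n} - 2 * card T) choose (r - card T)"
      if T: "T \<subseteq> {1..n}" "card T \<le> s" for T
    proof -
      have "real (card {e \<in> F. T \<subseteq> e}) \<le> c * real n ^ (r - card T)"
      proof (cases "card T = s")
        case True
        then have "T \<in> nsets {1..n} s" using T finite_subset by (auto simp: nsets_def)
        then have "real (card {e \<in> F. T \<subseteq> e}) \<le> c * real ((n - s) choose (r - s))"
          using deg by (meson less_imp_le)
        also have "\<dots> \<le> c * real n ^ (r - s)" using upper c by (intro mult_left_mono) auto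
        finally show ?thesis by (simp add: True)
      next
        \<comment> \<open>Here \<open>card T < s\<close>, so bounding the degree by
          \<open>card F\<close> suffices: the additional factor \<open>n\<close> is absorbed by
          \<open>r - card T \<ge> Suc (r - s)\<close>.\<close>
        case False
        have "real (card {e \<in> F. T \<subseteq> e}) \<le> real (card F)" using finF by (simp add: card_mono)
        also note few
        also have "c * real n * real ((n - s) choose (r - s)) \<le> c * real n * real n ^ (r - s)"
          using upper c by (intro mult_left_mono) auto
        also have "\<dots> = c * real n ^ Suc (r - s)" by simp
        also have "\<dots> \<le> c * real n ^ (r - card T)"
          using c n T False assms by (intro mult_left_mono power_increasing) auto
        finally show ?thesis .
      qed
      moreover have "(2::real) ^ card T \<le> 2 ^ s" using T by (intro power_increasing) auto
      ultimately have "2 ^ card T * real (card {e \<in> F. T \<subseteq> e}) \<le> 2 ^ s * (c * real n ^ (r - card T))"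
        by (intro mult_mono) auto
      also have "\<dots> = real n ^ (r - card T) / K / 2" by (simp add: c_def)
      also have "\<dots> < real n ^ (r - card T) / K" using n K by (simp add: divide_strict_left_mono)
      also have "\<dots> \<le> real ((n - 2 * card T) choose (r - card T))"
        unfolding K_def using n T assms by (intro binomial_ge_pow_div) auto
      finally have "real (2 ^ card T * card {e \<in> F. T \<subseteq> e}) < real ((n - 2 * card T) choose (r - card T))"
        by simp
      then show ?thesis by (simp only: of_nat_less_iff card_atLeastAtMost diff_Suc_1)
    qed
    have "mat_rank (inclusion_matrix s ?G) = card (verts ?G) choose s"
    proof (rule inclusion_matrix_full_rank)
      fix f :: "nat set \<Rightarrow> real" and S
      assume "\<And>e. e \<in> edges ?G \<Longrightarrow> (\<Sum>S\<in>nsets e s. f S) = 0" "S \<in> nsets (verts ?G) s"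
      then show "f S = 0"
        using inclusion_sums_determine[of "{1..n}" F s r f S] finF assms cond by (simp add: G)
    qed (auto simp: G finite_imp_finite_nsets nsets_def)
    then show ?thesis by (simp add: G)
  qed
  then show ?thesis using c
    \<comment> \<open>The threshold is the condition \<open>4 * r < n\<close> of
      \<open>binomial_ge_pow_div\<close>.\<close>
    by (intro exI[of _ c] exI[of _ "4 * r + 1"]) auto
qed

end
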